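(* Let $\mathbb{P}=(R,G)$ be a partial field, let $M$ be a matroid on ground set $E$ with basis $B$, and let $M=M[I\;A]$ for some $B\times(E\setminus B)$ $\mathbb{P}$-matrix $A$ that is $T$-normalized for a maximal spanning forest $T$ of $G(A)$. Then there exists a ring homomorphism $\phi:\mathbb{B}_{M,B,T}\to R$ such that $\phi(\hat A_{M,B,T})=A$ (with $\phi$ applied entrywise).
   Context: A partial field is a pair $\mathbb{P}=(R,G)$ with $R$ a commutative ring with identity and $G$ a subgroup of $R^*$ with $-1\in G$; as a set $\mathbb{P}=G\cup\{0\}$. An $X\times Y$ matrix (rows labelled by $X$, columns by $Y$, finite disjoint sets) with entries in $\mathbb{P}$ is a $\mathbb{P}$-matrix if the determinant of every square submatrix lies in $\mathbb{P}$. $M[I\;A]$ is the matroid on $X\cup Y$ whose bases are the sets $Z$ with $|Z|=|X|$ and $\det(A[X\setminus Z,Y\cap Z])\ne 0$ (the empty determinant is $1$). $G(A)$ is the bipartite graph on $X\cup Y$ with edges $xy$ ($x\in X$, $y\in Y$) for which $A_{xy}\neq 0$. $A$ is $T$-normalized, for a maximal spanning forest $T$ of $G(A)$, if $A_{xy}=1$ for all $xy\in T$. Let $M=(E,\mathcal{B})$ be a matroid of rank $r$ with set of bases $\mathcal{B}$, let $B\in\mathcal{B}$, and let $G(M,B)$ be the bipartite graph on $B\cup(E\setminus B)$ with edges $xy$ ($x\in B$, $y\in E\setminus B$) for which $(B\setminus x)\cup y\in\mathcal{B}$ (if $M=M[I\;A]$ with $A$ a $B\times(E\setminus B)$ matrix,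 then $G(M,B)=G(A)$). Let $T$ be a maximal spanning forest of $G(M,B)$. Introduce indeterminates $a_{xy}$ ($x\in B$, $y\in E\setminus B$) and $i_{B'}$ ($B'\in\mathcal{B}$), collected in the set $\mathcal{Y}_M$, and let $\hat A_{M,B}$ be the $B\times(E\setminus B)$ matrix with entries $a_{xy}$. Let $I_{M,B,T}$ be the ideal of $\mathbb{Z}[\mathcal{Y}_M]$ generated by, for all $Z\subseteq E$ with $|Z|=r$: $\det(\hat A_{M,B}[B\setminus Z,(E\setminus B)\cap Z])$ if $Z\notin\mathcal{B}$; $\det(\hat A_{M,B}[B\setminus Z,(E\setminus B)\cap Z])\,i_Z-1$ if $Z\in\mathcal{B}$; together with $a_{xy}-1$ for all $xy\in T$. Then $\mathbb{B}_{M,B,T}:=\mathbb{Z}[\mathcal{Y}_M]/I_{M,B,T}$, and $\hat A_{M,B,T}$ is the matrix $\hat A_{M,B}$ viewed over $\mathbb{B}_{M,B,T}$. *)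

theory Defs
  imports
    "HOL-Algebra.QuotRing"
    "HOL-Combinatorics.Permutations"
    "HOL-Library.Poly_Mapping"
begin

locale partial_field = cring R for R (structure) +
  fixes G
  assumes subgroup_units: "subgroup G (units_of R)"
    and minus_one_mem: "\<ominus> \<one> \<in> G"

locale matroid =
  fixes E :: "'e set" and \<B> :: "'e set set"
  assumes finite_ground: "finite E"
    and bases_subset: "\<B> \<subseteq> Pow E"
    and bases_nonempty: "\<B> \<noteq> {}"
    and basis_exchange:
      "\<lbrakk>B1 \<in> \<B>; B2 \<in> \<B>; x \<in> B1 - B2\<rbrakk> \<Longrightarrow> \<exists>y\<in>B2 - B1. insert y (B1 - {x}) \<in> \<B>"

text \<open>
  The Leibniz formula, over an arbitrary commutative ring given as a record.
  For \<open>n = 0\<close> it gives \<open>\<one>\<close>.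
\<close>

definition ring_det :: "('r, 'm) ring_scheme \<Rightarrow> nat \<Rightarrow> (nat \<Rightarrow> nat \<Rightarrow> 'r) \<Rightarrow> 'r" where
  "ring_det R n A =
     (\<Oplus>\<^bsub>R\<^esub>p\<in>{p. p permutes {..<n}}. [sign p] \<cdot>\<^bsub>R\<^esub> (\<Otimes>\<^bsub>R\<^esub>i\<in>{..<n}. A i (p i)))"

text \<open>
  Matrices with labelled rows and columns are functions of two labels. The sign of the
  determinant of a submatrix depends on an ordering of the labels. It is fixed by a list
  \<open>es\<close> enumerating the ground set: rows and columns of \<open>A[X', Y']\<close> appear in the order
  in which they occur in \<open>es\<close>. The value is meaningful only if \<open>X'\<close> and \<open>Y'\<close> have the
  same number of elements.
\<close>

definition sub_det ::
  "('r, 'm) ring_scheme \<Rightarrow> 'e list \<Rightarrow> ('e \<Rightarrow> 'e \<Rightarrow> 'r) \<Rightarrow> 'e set \<Rightarrow> 'e set \<Rightarrow> 'r" where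
  "sub_det R es A X' Y' =
     (let xs = filter (\<lambda>e. e \<in> X') es; ys = filter (\<lambda>e. e \<in> Y') es
      in ring_det R (length xs) (\<lambda>i j. A (xs ! i) (ys ! j)))"

definition pf_matrix ::
  "('r, 'm) ring_scheme \<Rightarrow> 'r set \<Rightarrow> 'e list \<Rightarrow> 'e set \<Rightarrow> 'e set \<Rightarrow> ('e \<Rightarrow> 'e \<Rightarrow> 'r) \<Rightarrow> bool" where
  "pf_matrix R G es X Y A \<longleftrightarrow>
     (\<forall>x\<in>X. \<forall>y\<in>Y. A x y \<in> G \<union> {\<zero>\<^bsub>R\<^esub>}) \<and>
     (\<forall>X' Y'. X' \<subseteq> X \<and> Y' \<subseteq> Y \<and> card X' = card Y' \<longrightarrow> sub_det R es A X' Y' \<in> G \<union> {\<zero>\<^bsub>R\<^esub>})"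

text \<open>The matroid \<open>M[I A]\<close>, as a pair of ground set and set of bases.\<close>

definition matroid_IA ::
  "('r, 'm) ring_scheme \<Rightarrow> 'e list \<Rightarrow> 'e set \<Rightarrow> 'e set \<Rightarrow> ('e \<Rightarrow> 'e \<Rightarrow> 'r) \<Rightarrow> 'e set \<times> 'e set set" where
  "matroid_IA R es X Y A =
     (X \<union> Y, {Z. Z \<subseteq> X \<union> Y \<and> card Z = card X \<and> sub_det R es A (X - Z) (Y \<inter> Z) \<noteq> \<zero>\<^bsub>R\<^esub>})"

text \<open>
  Graphs are given by their edge sets, an edge being the unordered pair of its endpoints.
  A spanning subgraph has all the vertices of the graph, so it too is just a set of edges.
\<close>

definition bipartite_graph ::
  "('r, 'm) ring_scheme \<Rightarrow> 'e set \<Rightarrow> 'e set \<Rightarrow> ('e \<Rightarrow> 'e \<Rightarrow> 'r) \<Rightarrow> 'e set set" where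
  "bipartite_graph R X Y A = {{x, y} | x y. x \<in> X \<and> y \<in> Y \<and> A x y \<noteq> \<zero>\<^bsub>R\<^esub>}"

definition graph_cycle :: "'e set set \<Rightarrow> 'e list \<Rightarrow> bool" where
  "graph_cycle F c \<longleftrightarrow>
     3 \<le> length c \<and> distinct c \<and> (\<forall>i<length c. {c ! i, c ! (Suc i mod length c)} \<in> F)"

definition graph_forest :: "'e set set \<Rightarrow> bool" where
  "graph_forest F \<longleftrightarrow> (\<nexists>c. graph_cycle F c)"

definition maximal_spanning_forest :: "'e set set \<Rightarrow> 'e set set \<Rightarrow> bool" where
  "maximal_spanning_forest F T \<longleftrightarrow>
     T \<subseteq> F \<and> graph_forest T \<and> (\<forall>T'. T \<subseteq> T' \<and> T' \<subseteq> F \<and> graph_forest T' \<longrightarrow> T' = T)"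

definition normalized ::
  "('r, 'm) ring_scheme \<Rightarrow> 'e set \<Rightarrow> 'e set \<Rightarrow> 'e set set \<Rightarrow> ('e \<Rightarrow> 'e \<Rightarrow> 'r) \<Rightarrow> bool" where
  "normalized R X Y T A \<longleftrightarrow> (\<forall>x\<in>X. \<forall>y\<in>Y. {x, y} \<in> T \<longrightarrow> A x y = \<one>\<^bsub>R\<^esub>)"

text \<open>
  A monomial is a finitely supported exponent function, and a polynomial maps finitely
  many monomials to nonzero integer coefficients; the multiplication of \<open>poly_mapping\<close> is
  convolution. The carrier consists of the polynomials in the variables \<open>V\<close> only.
\<close>

type_synonym 'v int_mpoly = "('v \<Rightarrow>\<^sub>0 nat) \<Rightarrow>\<^sub>0 int"

definition int_poly_ring :: "'v set \<Rightarrow> 'v int_mpoly ring" where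
  "int_poly_ring V =
     \<lparr>carrier = {p. \<forall>m\<in>Poly_Mapping.keys p. Poly_Mapping.keys m \<subseteq> V},
      monoid.mult = (*), one = 1, zero = 0, add = (+)\<rparr>"

definition poly_var :: "'v \<Rightarrow> 'v int_mpoly" where
  "poly_var v = Poly_Mapping.single (Poly_Mapping.single v 1) 1"

text \<open>\<open>EntryVar x y\<close> is the indeterminate \<open>a\<^sub>x\<^sub>y\<close>, and \<open>InvVar Z\<close> is \<open>i\<^sub>Z\<close>.\<close>

datatype 'e indet = EntryVar 'e 'e | InvVar "'e set"

definition indets :: "'e set \<Rightarrow> 'e set set \<Rightarrow> 'e set \<Rightarrow> 'e indet set" where
  "indets E \<B> B = {EntryVar x y | x y. x \<in> B \<and> y \<in> E - B} \<union> InvVar ` \<B>"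

definition generic_matrix :: "'e \<Rightarrow> 'e \<Rightarrow> 'e indet int_mpoly" where
  "generic_matrix x y = poly_var (EntryVar x y)"

text \<open>Since \<open>B\<close> is a basis, \<open>card B\<close> is the rank of the matroid.\<close>

definition bracket_ideal ::
  "'e list \<Rightarrow> 'e set \<Rightarrow> 'e set set \<Rightarrow> 'e set \<Rightarrow> 'e set set \<Rightarrow> 'e indet int_mpoly set" where
  "bracket_ideal es E \<B> B T =
     (let P = int_poly_ring (indets E \<B> B);
          D = (\<lambda>Z. sub_det P es generic_matrix (B - Z) ((E - B) \<inter> Z))
      in Idl\<^bsub>P\<^esub>
         ({D Z | Z. Z \<subseteq> E \<and> card Z = card B \<and> Z \<notin> \<B>} \<union>
          {D Z \<otimes>\<^bsub>P\<^esub> poly_var (InvVar Z) \<ominus>\<^bsub>P\<^esub> \<one>\<^bsub>P\<^esub> | Z. Z \<subseteq> E \<and> card Z = card B \<and> Z \<in> \<B>} \<union>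
          {generic_matrix x y \<ominus>\<^bsub>P\<^esub> \<one>\<^bsub>P\<^esub> | x y. x \<in> B \<and> y \<in> E - B \<and> {x, y} \<in> T}))"

definition bracket_ring ::
  "'e list \<Rightarrow> 'e set \<Rightarrow> 'e set set \<Rightarrow> 'e set \<Rightarrow> 'e set set \<Rightarrow> 'e indet int_mpoly set ring" where
  "bracket_ring es E \<B> B T = int_poly_ring (indets E \<B> B) Quot bracket_ideal es E \<B> B T"

definition bracket_matrix ::
  "'e list \<Rightarrow> 'e set \<Rightarrow> 'e set set \<Rightarrow> 'e set \<Rightarrow> 'e set set \<Rightarrow> 'e \<Rightarrow> 'e \<Rightarrow> 'e indet int_mpoly set" where
  "bracket_matrix es E \<B> B T x y =
     bracket_ideal es E \<B> B T +>\<^bsub>int_poly_ring (indets E \<B> B)\<^esub> generic_matrix x y"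

end

theory Submission
  imports Defs
begin

text \<open>
  Substituting the entries of \<open>A\<close> for the variables \<open>a\<^sub>x\<^sub>y\<close>, and the inverse of the
  corresponding subdeterminant of \<open>A\<close> for \<open>i\<^sub>Z\<close>, is a ring homomorphism from the polynomial
  ring to \<open>R\<close>. The inverses exist because a nonzero subdeterminant of a \<open>\<P>\<close>-matrix lies in
  \<open>G\<close>. Every generator of the ideal is mapped to zero, so the homomorphism factors through
  the quotient.
\<close>

subsection \<open>Homomorphisms out of a quotient, and determinants\<close>

text \<open>Since \<open>h\<close> kills \<open>I\<close>, it is constant on every coset of
  \<open>I\<close>, so the image of a coset is a singleton and \<open>the_elem\<close> extracts its
  element. This avoids a choice of representatives; the homomorphism laws follow because the
  quotient operations are computed on representatives.\<close>

lemma (in ring_hom_ring) factor_through_quotient: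
  assumes "ideal I R" and "I \<subseteq> a_kernel R S h"
  shows "\<exists>\<phi>\<in>ring_hom (R Quot I) S. \<forall>x\<in>carrier R. \<phi> (I +> x) = h x"
proof -
  interpret I: ideal I R by fact
  define \<phi> where "\<phi> X = the_elem (h ` X)" for X
  have \<phi>: "\<phi> (I +> x) = h x" if x: "x \<in> carrier R" for x
  proof -
    have "h y = h x" if "y \<in> I +> x" for y
    proof -
      obtain i where i: "i \<in> I" "y = i \<oplus> x"
        using \<open>y \<in> I +> x\<close> unfolding a_r_coset_def' by blast
      then have "i \<in> carrier R" "h i = \<zero>\<^bsub>S\<^esub>"
        using assms(2) unfolding a_kernel_def' by blast+
      then show ?thesis using i(2) x by simp
    qed
    moreover have "x \<in> I +> x"
      using I.a_rcos_self x by blast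
    ultimately have "h ` (I +> x) = {h x}"
      by blast
    then show ?thesis by (simp add: \<phi>_def)
  qed
  have "\<phi> \<in> ring_hom (R Quot I) S"
  proof (rule ring_hom_memI)
    fix X assume "X \<in> carrier (R Quot I)"
    then show "\<phi> X \<in> carrier S"
      by (auto simp: FactRing_simps \<phi>)
  next
    fix X Y assume "X \<in> carrier (R Quot I)" "Y \<in> carrier (R Quot I)"
    then obtain x y where xy: "x \<in> carrier R" "y \<in> carrier R" "X = I +> x" "Y = I +> y"
      by (auto simp: FactRing_simps)
    then show "\<phi> (X \<otimes>\<^bsub>R Quot I\<^esub> Y) = \<phi> X \<otimes>\<^bsub>S\<^esub> \<phi> Y"
      by (simp add: FactRing_def I.rcoset_mult_add \<phi>)
    show "\<phi> (X \<oplus>\<^bsub>R Quot I\<^esub> Y) = \<phi> X \<oplus>\<^bsub>S\<^esub> \<phi> Y"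
      using xy by (simp add: FactRing_def I.a_rcos_sum \<phi>)
  next
    show "\<phi> \<one>\<^bsub>R Quot I\<^esub> = \<one>\<^bsub>S\<^esub>"
      by (simp add: FactRing_def \<phi>)
  qed
  with \<phi> show ?thesis by blast
qed

section \<open>Determinants and ring homomorphisms\<close>

lemma (in cring) ring_det_closed:
  assumes "\<And>i j. i < n \<Longrightarrow> j < n \<Longrightarrow> A i j \<in> carrier R"
  shows "ring_det R n A \<in> carrier R"
  unfolding ring_det_def
  by (intro finsum_closed Pi_I add.int_pow_closed finprod_closed assms)
    (auto dest: permutes_in_image)

text \<open>The Leibniz formula uses only finite sums, finite products and integer multiples, and a
  ring homomorphism preserves each of them.\<close>

lemma (in ring_hom_cring) hom_ring_det:
  assumes "\<And>i j. i < n \<Longrightarrow> j < n \<Longrightarrow> A i j \<in> carrier R"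
  shows "h (ring_det R n A) = ring_det S n (\<lambda>i j. h (A i j))"
proof -
  have in_R: "A i (p i) \<in> carrier R" if "p permutes {..<n}" "i < n" for p i
    using that assms permutes_in_image[of p "{..<n}" i] by simp
  have term_R: "(\<Otimes>i\<in>{..<n}. A i (p i)) \<in> carrier R" if "p permutes {..<n}" for p
    using in_R[OF that] by (intro R.finprod_closed) auto
  have hom_term: "h ([sign p] \<cdot> (\<Otimes>i\<in>{..<n}. A i (p i))) =
      [sign p] \<cdot>\<^bsub>S\<^esub> (\<Otimes>\<^bsub>S\<^esub>i\<in>{..<n}. h (A i (p i)))" if p: "p permutes {..<n}" for p
  proof -
    \<comment> \<open>The integer multiple by the sign is a power in the additive group, so it is
      preserved by \<open>h\<close> as a homomorphism of additive groups.\<close>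
    have "h ([sign p] \<cdot> (\<Otimes>i\<in>{..<n}. A i (p i))) =
        [sign p] \<cdot>\<^bsub>S\<^esub> h (\<Otimes>i\<in>{..<n}. A i (p i))"
      using term_R[OF p] group_hom.hom_int_pow[OF ring.a_group_hom]
      by (simp add: add_pow_def)
    also have "h (\<Otimes>i\<in>{..<n}. A i (p i)) = (\<Otimes>\<^bsub>S\<^esub>i\<in>{..<n}. h (A i (p i)))"
      using in_R[OF p] by (subst hom_finprod) (auto simp: o_def)
    finally show ?thesis .
  qed
  have in_S: "h (A i (p i)) \<in> carrier S" if "p permutes {..<n}" "i < n" for p i
    using in_R[OF that] by simp
  have "h (ring_det R n A) =
      (\<Oplus>\<^bsub>S\<^esub>p\<in>{p. p permutes {..<n}}. h ([sign p] \<cdot> (\<Otimes>i\<in>{..<n}. A i (p i))))"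
    unfolding ring_det_def using term_R by (subst hom_finsum) (auto simp: o_def)
  also have "\<dots> = ring_det S n (\<lambda>i j. h (A i j))"
    unfolding ring_det_def using in_S
    by (intro S.finsum_cong') (auto simp: hom_term intro!: S.finprod_closed)
  finally show ?thesis .
qed

text \<open>\<open>sub_det\<close> takes its size from the row list alone. Equal lengths keep the
  column indices in range, so that only entries with labels in \<open>X\<close> and \<open>Y\<close>
  occur and nothing has to be assumed about the others.\<close>

lemma (in ring_hom_cring) hom_sub_det:
  assumes "length (filter (\<lambda>e. e \<in> X) es) = length (filter (\<lambda>e. e \<in> Y) es)"
    and "\<And>x y. x \<in> X \<Longrightarrow> y \<in> Y \<Longrightarrow> A x y \<in> carrier R"
  shows "h (sub_det R es A X Y) = sub_det S es (\<lambda>x y. h (A x y)) X Y"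
proof -
  have "filter (\<lambda>e. e \<in> X) es ! i \<in> X" if "i < length (filter (\<lambda>e. e \<in> X) es)" for X i
    using nth_mem[OF that] by simp
  then show ?thesis
    unfolding sub_det_def Let_def using assms by (intro hom_ring_det) auto
qed

lemma (in cring) sub_det_closed:
  assumes "length (filter (\<lambda>e. e \<in> X) es) = length (filter (\<lambda>e. e \<in> Y) es)"
    and "\<And>x y. x \<in> X \<Longrightarrow> y \<in> Y \<Longrightarrow> A x y \<in> carrier R"
  shows "sub_det R es A X Y \<in> carrier R"
proof -
  have "filter (\<lambda>e. e \<in> X) es ! i \<in> X" if "i < length (filter (\<lambda>e. e \<in> X) es)" for X i
    using nth_mem[OF that] by simp
  then show ?thesis
    unfolding sub_det_def Let_def using assms by (intro ring_det_closed) auto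
qed

text \<open>Matrices here are total functions of two labels, and the evaluated generic matrix is
  only known to agree with \<open>A\<close> on the block with rows \<open>B\<close> and columns
  \<open>E - B\<close>. The carrier condition is what the congruence rules for ring sums and
  products ask for.\<close>

lemma sub_det_cong:
  assumes "length (filter (\<lambda>e. e \<in> X) es) = length (filter (\<lambda>e. e \<in> Y) es)"
    and "cring R"
    and "\<And>x y. x \<in> X \<Longrightarrow> y \<in> Y \<Longrightarrow> A x y = A' x y"
    and "\<And>x y. x \<in> X \<Longrightarrow> y \<in> Y \<Longrightarrow> A' x y \<in> carrier R"
  shows "sub_det R es A X Y = sub_det R es A' X Y"
proof -
  interpret cring R by fact
  have *: "filter (\<lambda>e. e \<in> X) es ! i \<in> X" if "i < length (filter (\<lambda>e. e \<in> X) es)" for X i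
    using nth_mem[OF that] by simp
  define n where "n = length (filter (\<lambda>e. e \<in> X) es)"
  have entries: "filter (\<lambda>e. e \<in> X) es ! i \<in> X" "filter (\<lambda>e. e \<in> Y) es ! p i \<in> Y"
    if "p permutes {..<n}" "i < n" for p i
    using that assms(1) permutes_in_image[OF that(1), of i] by (auto intro!: * simp: n_def)
  show ?thesis
    unfolding sub_det_def ring_det_def Let_def n_def[symmetric]
    using entries assms(3,4)
    by (intro finsum_cong' arg_cong[where f = "add_pow R _"] finprod_cong')
      (auto intro!: finprod_closed)
qed

subsection \<open>Integer polynomials and their evaluation\<close>

lemma int_poly_ring_simps [simp]:
  "p \<in> carrier (int_poly_ring V) \<longleftrightarrow> (\<forall>m\<in>Poly_Mapping.keys p. Poly_Mapping.keys m \<subseteq> V)"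
  "p \<otimes>\<^bsub>int_poly_ring V\<^esub> q = p * q"
  "p \<oplus>\<^bsub>int_poly_ring V\<^esub> q = p + q"
  "\<one>\<^bsub>int_poly_ring V\<^esub> = 1"
  "\<zero>\<^bsub>int_poly_ring V\<^esub> = 0"
  by (simp_all add: int_poly_ring_def)

text \<open>The ring laws are inherited from the polynomial type, so the point is closure of the
  carrier. For products, every monomial of \<open>p * q\<close> is a sum of a monomial of
  \<open>p\<close> and one of \<open>q\<close>, and hence involves only variables in
  \<open>V\<close>.\<close>

lemma cring_int_poly_ring: "cring (int_poly_ring V)"
proof (rule cringI)
  show "abelian_group (int_poly_ring V)"
  proof (rule abelian_groupI)
    fix p assume "p \<in> carrier (int_poly_ring V)"
    then show "\<exists>q\<in>carrier (int_poly_ring V). q \<oplus>\<^bsub>int_poly_ring V\<^esub> p = \<zero>\<^bsub>int_poly_ring V\<^esub>"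
      by (intro bexI[of _ "- p"]) auto
  qed (use keys_add in \<open>(fastforce simp: ac_simps)+\<close>)
  show "Group.comm_monoid (int_poly_ring V)"
  proof (rule comm_monoidI)
    fix p q assume pq: "p \<in> carrier (int_poly_ring V)" "q \<in> carrier (int_poly_ring V)"
    have "Poly_Mapping.keys m \<subseteq> V" if m: "m \<in> Poly_Mapping.keys (p * q)" for m
    proof -
      obtain a b where "m = a + b" "a \<in> Poly_Mapping.keys p" "b \<in> Poly_Mapping.keys q"
        using keys_mult[of p q] m by blast
      then show ?thesis
        using keys_add[of a b] pq by (simp, blast)
    qed
    then show "p \<otimes>\<^bsub>int_poly_ring V\<^esub> q \<in> carrier (int_poly_ring V)"
      by simp
  qed (auto simp: ac_simps)
qed (simp add: distrib_right)

section \<open>Evaluation of integer polynomials in a commutative ring\<close>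

context cring
begin

definition eval_monom :: "('v \<Rightarrow> 'a) \<Rightarrow> ('v \<Rightarrow>\<^sub>0 nat) \<Rightarrow> 'a" where
  "eval_monom s m = (\<Otimes>v\<in>Poly_Mapping.keys m. s v [^] Poly_Mapping.lookup m v)"

definition eval_poly :: "('v \<Rightarrow> 'a) \<Rightarrow> 'v int_mpoly \<Rightarrow> 'a" where
  "eval_poly s p = (\<Oplus>m\<in>Poly_Mapping.keys p. [Poly_Mapping.lookup p m] \<cdot> eval_monom s m)"

context
  fixes s :: "'v \<Rightarrow> 'a"
  assumes s: "\<And>v. s v \<in> carrier R"
begin

lemma eval_monom_closed: "eval_monom s m \<in> carrier R"
  unfolding eval_monom_def by (auto intro!: finprod_closed simp: s)

text \<open>The additional factors have exponent zero and equal one. Monomials with different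
  supports can thus be multiplied over a common index set.\<close>

lemma eval_monom_superset:
  assumes "finite K" "Poly_Mapping.keys m \<subseteq> K"
  shows "eval_monom s m = (\<Otimes>v\<in>K. s v [^] Poly_Mapping.lookup m v)"
  unfolding eval_monom_def using assms s
  by (intro finprod_mono_neutral_cong_left) (auto simp: in_keys_iff)

lemma eval_monom_add: "eval_monom s (m + n) = eval_monom s m \<otimes> eval_monom s n"
proof -
  let ?K = "Poly_Mapping.keys m \<union> Poly_Mapping.keys n"
  have "eval_monom s (m + n) = (\<Otimes>v\<in>?K. s v [^] Poly_Mapping.lookup (m + n) v)"
    by (rule eval_monom_superset) (auto simp: keys_add)
  also have "\<dots> =
      (\<Otimes>v\<in>?K. s v [^] Poly_Mapping.lookup m v \<otimes> s v [^] Poly_Mapping.lookup n v)"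
    using s by (intro finprod_cong') (auto simp: lookup_add nat_pow_mult)
  also have "\<dots> = eval_monom s m \<otimes> eval_monom s n"
    using s by (subst finprod_multf) (auto simp: eval_monom_superset[of ?K])
  finally show ?thesis .
qed

lemma eval_poly_closed: "eval_poly s p \<in> carrier R"
  unfolding eval_poly_def
  by (intro finsum_closed Pi_I add.int_pow_closed eval_monom_closed)

text \<open>The additional summands have coefficient zero. A common index set is needed for sums of
  polynomials, because cancellation may make the support of \<open>p + q\<close> smaller than the
  union of the supports.\<close>

lemma eval_poly_superset:
  assumes "finite K" "Poly_Mapping.keys p \<subseteq> K"
  shows "eval_poly s p = (\<Oplus>m\<in>K. [Poly_Mapping.lookup p m] \<cdot> eval_monom s m)"
proof -
  have "[(0::int)] \<cdot> x = \<zero>" for x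
    by (simp add: add_pow_def)
  then show ?thesis
    unfolding eval_poly_def using assms eval_monom_closed
    by (intro add.finprod_mono_neutral_cong_left) (auto simp: in_keys_iff)
qed

lemma eval_poly_add: "eval_poly s (p + q) = eval_poly s p \<oplus> eval_poly s q"
proof -
  let ?K = "Poly_Mapping.keys p \<union> Poly_Mapping.keys q"
  have "eval_poly s (p + q) = (\<Oplus>m\<in>?K. [Poly_Mapping.lookup (p + q) m] \<cdot> eval_monom s m)"
    by (rule eval_poly_superset) (auto simp: keys_add)
  also have "\<dots> = (\<Oplus>m\<in>?K. [Poly_Mapping.lookup p m] \<cdot> eval_monom s m \<oplus>
      [Poly_Mapping.lookup q m] \<cdot> eval_monom s m)"
    using eval_monom_closed
    by (intro finsum_cong') (auto simp: lookup_add add.int_pow_mult)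
  also have "\<dots> = eval_poly s p \<oplus> eval_poly s q"
    using eval_monom_closed by (subst finsum_addf) (auto simp: eval_poly_superset[of ?K])
  finally show ?thesis .
qed

lemma eval_poly_zero: "eval_poly s 0 = \<zero>"
  by (simp add: eval_poly_def)

lemma eval_poly_single: "eval_poly s (Poly_Mapping.single m 1) = eval_monom s m"
  using eval_monom_closed by (simp add: eval_poly_def)

lemma eval_poly_one: "eval_poly s 1 = \<one>"
  using eval_poly_single[of 0] by (simp add: eval_monom_def)

lemma eval_poly_diff: "eval_poly s (p - q) = eval_poly s p \<ominus> eval_poly s q"
proof -
  have "eval_poly s (p - q) \<oplus> eval_poly s q = eval_poly s p"
    by (metis eval_poly_add diff_add_cancel)
  then show ?thesis
    using eval_poly_closed[of p] eval_poly_closed[of q] eval_poly_closed[of "p - q"]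
    by (metis a_minus_def a_inv_closed a_assoc r_neg r_zero)
qed

text \<open>Additively, the polynomials form the free abelian group on the monomials. Induction over
  zero, generators and differences, first in \<open>p\<close> and then in \<open>q\<close>, reduces
  the claim by distributivity to two monomials with coefficient one, where it is
  \<open>eval_monom_add\<close>.\<close>

lemma eval_poly_mult: "eval_poly s (p * q) = eval_poly s p \<otimes> eval_poly s q"
proof (induction p rule: frag_induction[OF subset_UNIV])
  case 1
  show ?case by (simp add: eval_poly_zero eval_poly_closed)
next
  case (2 m)
  show ?case
  proof (induction q rule: frag_induction[OF subset_UNIV])
    case 1
    show ?case by (simp add: eval_poly_zero eval_poly_closed)
  next
    case (2 n)
    show ?case by (simp add: mult_single eval_poly_single eval_monom_add)
  next
    case (3 a b)
    then show ?case
      by (simp add: right_diff_distrib eval_poly_diff a_minus_def r_distr r_minus eval_poly_closed)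
  qed
next
  case (3 a b)
  then show ?case
    by (simp add: left_diff_distrib eval_poly_diff a_minus_def l_distr l_minus eval_poly_closed)
qed

lemma eval_poly_var: "eval_poly s (poly_var v) = s v"
  using s by (simp add: poly_var_def eval_poly_single eval_monom_def)

lemma eval_poly_hom: "ring_hom_cring (int_poly_ring V) R (eval_poly s)"
proof (rule ring_hom_cringI)
  show "ring_hom_ring (int_poly_ring V) R (eval_poly s)"
    using cring.axioms(1)[OF cring_int_poly_ring] ring_axioms
    by (rule ring_hom_ringI)
      (simp_all add: eval_poly_closed eval_poly_mult eval_poly_add eval_poly_one)
qed (simp_all add: cring_int_poly_ring is_cring)

end

end

subsection \<open>The evaluation factors through the bracket ring\<close>

lemma (in partial_field) pf_matrix_sub_det_Units:
  assumes "pf_matrix R G es X Y A" "X' \<subseteq> X" "Y' \<subseteq> Y" "card X' = card Y'"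
    and "sub_det R es A X' Y' \<noteq> \<zero>"
  shows "sub_det R es A X' Y' \<in> Units R"
proof -
  have "sub_det R es A X' Y' \<in> G"
    using assms unfolding pf_matrix_def by blast
  then show ?thesis
    using subgroup.subset[OF subgroup_units] by (auto simp: units_of_def)
qed

theorem lemma4p11:
  fixes R :: "('r, 'm) ring_scheme" and G :: "'r set"
    and E :: "'e set" and \<B> :: "'e set set" and B :: "'e set"
    and es :: "'e list" and A :: "'e \<Rightarrow> 'e \<Rightarrow> 'r" and T :: "'e set set"
  assumes "partial_field R G"
    and "matroid E \<B>" and "B \<in> \<B>"
    and "distinct es" and "set es = E"
    and "pf_matrix R G es B (E - B) A"
    and "(E, \<B>) = matroid_IA R es B (E - B) A"
    and "maximal_spanning_forest (bipartite_graph R B (E - B) A) T"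
    and "normalized R B (E - B) T A"
  shows "\<exists>\<phi>\<in>ring_hom (bracket_ring es E \<B> B T) R.
           \<forall>x\<in>B. \<forall>y\<in>E - B. \<phi> (bracket_matrix es E \<B> B T x y) = A x y"
proof -
  interpret partial_field R G by fact
  interpret M: matroid E \<B> by fact
  define P where "P = int_poly_ring (indets E \<B> B)"
  define d where "d Z = sub_det R es A (B - Z) ((E - B) \<inter> Z)" for Z
  define D where "D Z = sub_det P es generic_matrix (B - Z) ((E - B) \<inter> Z)" for Z
  \<comment> \<open>The default value one serves for indeterminates outside
    \<open>indets E \<B> B\<close>: evaluation is defined on the whole polynomial type, so
    \<open>s\<close> must lie in the carrier of \<open>R\<close> at every variable.\<close>
  define s where "s v = (case v of
      EntryVar x y \<Rightarrow> if x \<in> B \<and> y \<in> E - B then A x y else \<one>\<^bsub>R\<^esub>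
    | InvVar Z \<Rightarrow> if Z \<in> \<B> then inv\<^bsub>R\<^esub> (d Z) else \<one>\<^bsub>R\<^esub>)" for v
  have BE: "B \<subseteq> E"
    using M.bases_subset assms(3) by blast
  have finB: "finite B"
    using BE M.finite_ground finite_subset by blast
  have G_carrier: "G \<subseteq> carrier R"
    using subgroup.subset[OF subgroup_units] by (auto simp: units_of_def)
  have A_carrier: "A x y \<in> carrier R" if "x \<in> B" "y \<in> E - B" for x y
  proof -
    have "A x y \<in> G \<union> {\<zero>\<^bsub>R\<^esub>}"
      using conjunct1[OF assms(6)[unfolded pf_matrix_def]] that by blast
    then show ?thesis using G_carrier by auto
  qed
  \<comment> \<open>Both directions matter: a basis has a nonzero minor, which is then invertible,
    and a non-basis of size \<open>card B\<close> has a vanishing minor, as the first family of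
    generators demands.\<close>
  have bases: "Z \<in> \<B> \<longleftrightarrow> Z \<subseteq> E \<and> card Z = card B \<and> d Z \<noteq> \<zero>\<^bsub>R\<^esub>" for Z
  proof -
    have "\<B> = {Z. Z \<subseteq> B \<union> (E - B) \<and> card Z = card B \<and> d Z \<noteq> \<zero>\<^bsub>R\<^esub>}"
      using assms(7) by (simp add: matroid_IA_def d_def)
    moreover have "B \<union> (E - B) = E"
      using BE by blast
    ultimately show ?thesis by simp
  qed
  \<comment> \<open>Removing the common part \<open>B \<inter> Z\<close> from two sets of equal size
    leaves sets of equal size, so the submatrix belonging to \<open>Z\<close> is square.\<close>
  have card_eq: "card (B - Z) = card ((E - B) \<inter> Z)" if "Z \<subseteq> E" "card Z = card B" for Z
  proof -
    have finZ: "finite Z"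
      using that M.finite_ground finite_subset by blast
    have "(E - B) \<inter> Z = Z - B"
      using that by blast
    moreover have "card (B - Z) + card (B \<inter> Z) = card (Z - B) + card (Z \<inter> B)"
      using card_Int_Diff[OF finB, of Z] card_Int_Diff[OF finZ, of B] that by simp
    ultimately show ?thesis
      by (simp add: Int_commute)
  qed
  \<comment> \<open>As \<open>es\<close> lists each element of \<open>E\<close> exactly once, the
    filtered lists have the cardinalities of the sets as lengths.\<close>
  have len_eq: "length (filter (\<lambda>e. e \<in> B - Z) es) = length (filter (\<lambda>e. e \<in> (E - B) \<inter> Z) es)"
    if "Z \<subseteq> E" "card Z = card B" for Z
  proof -
    have "length (filter (\<lambda>e. e \<in> X) es) = card X" if "X \<subseteq> E" for X
    proof -
      have "set (filter (\<lambda>e. e \<in> X) es) = X"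
        using that assms(5) by auto
      then show ?thesis
        using distinct_card[OF distinct_filter[OF assms(4), of "\<lambda>e. e \<in> X"]] by metis
    qed
    moreover have "B - Z \<subseteq> E" "(E - B) \<inter> Z \<subseteq> E"
      using BE by auto
    ultimately show ?thesis
      using card_eq[OF that] by metis
  qed
  have d_unit: "d Z \<in> Units R" if "Z \<in> \<B>" for Z
    unfolding d_def
    using that card_eq[of Z] bases[of Z]
    by (intro pf_matrix_sub_det_Units[OF assms(6)]) (auto simp: d_def)
  have s: "s v \<in> carrier R" for v
    using A_carrier d_unit by (auto simp: s_def split: indet.split)
  interpret h: ring_hom_cring P R "eval_poly s"
    unfolding P_def by (rule eval_poly_hom[OF s])
  have entry_P: "generic_matrix x y \<in> carrier P" if "x \<in> B" "y \<in> E - B" for x y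
    using that by (auto simp: P_def generic_matrix_def poly_var_def indets_def)
  have inv_P: "poly_var (InvVar Z) \<in> carrier P" if "Z \<in> \<B>" for Z
    using that by (auto simp: P_def poly_var_def indets_def)
  have h_var: "eval_poly s (poly_var v) = s v" for v
    by (rule eval_poly_var[OF s])
  have h_entry: "eval_poly s (generic_matrix x y) = A x y" if "x \<in> B" "y \<in> E - B" for x y
    using that unfolding generic_matrix_def h_var by (simp add: s_def)
  have D_P: "D Z \<in> carrier P" if "Z \<subseteq> E" "card Z = card B" for Z
    unfolding D_def using len_eq[OF that] by (rule h.R.sub_det_closed) (auto intro: entry_P)
  \<comment> \<open>The evaluation is first moved inside the determinant, after which the entries
    are replaced by those of \<open>A\<close> on the relevant block.\<close>
  have h_D: "eval_poly s (D Z) = d Z" if "Z \<subseteq> E" "card Z = card B" for Z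
  proof -
    have "eval_poly s (D Z) =
        sub_det R es (\<lambda>x y. eval_poly s (generic_matrix x y)) (B - Z) ((E - B) \<inter> Z)"
      unfolding D_def using len_eq[OF that] by (rule h.hom_sub_det) (auto intro: entry_P)
    also have "\<dots> = d Z"
      unfolding d_def using len_eq[OF that] is_cring
      by (rule sub_det_cong) (auto simp: h_entry A_carrier)
    finally show ?thesis .
  qed

  \<comment> \<open>Vanishing of the generators and passage to the quotient\<close>
  define gens where "gens =
      {D Z | Z. Z \<subseteq> E \<and> card Z = card B \<and> Z \<notin> \<B>} \<union>
      {D Z \<otimes>\<^bsub>P\<^esub> poly_var (InvVar Z) \<ominus>\<^bsub>P\<^esub> \<one>\<^bsub>P\<^esub> | Z. Z \<subseteq> E \<and> card Z = card B \<and> Z \<in> \<B>} \<union>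
      {generic_matrix x y \<ominus>\<^bsub>P\<^esub> \<one>\<^bsub>P\<^esub> | x y. x \<in> B \<and> y \<in> E - B \<and> {x, y} \<in> T}"
  have ideal_eq: "bracket_ideal es E \<B> B T = Idl\<^bsub>P\<^esub> gens"
    unfolding bracket_ideal_def gens_def D_def P_def Let_def ..
  have gens_kernel: "gens \<subseteq> a_kernel P R (eval_poly s)"
  proof
    fix p assume "p \<in> gens"
    then consider
        (nonbasis) Z where "p = D Z" "Z \<subseteq> E" "card Z = card B" "Z \<notin> \<B>"
      | (basis) Z where "p = D Z \<otimes>\<^bsub>P\<^esub> poly_var (InvVar Z) \<ominus>\<^bsub>P\<^esub> \<one>\<^bsub>P\<^esub>"
          "Z \<subseteq> E" "card Z = card B" "Z \<in> \<B>"
      | (forest) x y where "p = generic_matrix x y \<ominus>\<^bsub>P\<^esub> \<one>\<^bsub>P\<^esub>" "x \<in> B" "y \<in> E - B" "{x, y} \<in> T"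
      unfolding gens_def by blast
    \<comment> \<open>The three families vanish for different reasons: the minor of a non-basis is
      zero, the unit \<open>d Z\<close> cancels against its inverse, and the entries of
      \<open>A\<close> on the edges of \<open>T\<close> are one by normalization.\<close>
    then have "p \<in> carrier P \<and> eval_poly s p = \<zero>\<^bsub>R\<^esub>"
    proof cases
      case nonbasis
      then show ?thesis using bases[of Z] D_P[of Z] h_D[of Z] by simp
    next
      case basis
      have "eval_poly s (poly_var (InvVar Z)) = inv\<^bsub>R\<^esub> (d Z)"
        using basis unfolding h_var by (simp add: s_def)
      then show ?thesis
        using basis D_P[of Z] inv_P[of Z] h_D[of Z] d_unit[of Z]
        by (simp add: a_minus_def r_neg)
    next
      case forest
      have "A x y = \<one>\<^bsub>R\<^esub>"
        using assms(9) forest unfolding normalized_def by blast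
      then show ?thesis
        using forest entry_P[of x y] h_entry[of x y]
        by (simp add: a_minus_def r_neg)
    qed
    then show "p \<in> a_kernel P R (eval_poly s)"
      unfolding a_kernel_def' by blast
  qed
  then have "gens \<subseteq> carrier P"
    unfolding a_kernel_def' by blast
  then have "ideal (Idl\<^bsub>P\<^esub> gens) P"
    by (rule h.R.genideal_ideal)
  \<comment> \<open>The kernel is itself an ideal, so containing the generators it contains the
    ideal they generate.\<close>
  moreover have "Idl\<^bsub>P\<^esub> gens \<subseteq> a_kernel P R (eval_poly s)"
    using h.ring.kernel_is_ideal gens_kernel by (rule h.R.genideal_minimal)
  ultimately obtain \<phi> where \<phi>: "\<phi> \<in> ring_hom (P Quot Idl\<^bsub>P\<^esub> gens) R"
      "\<And>p. p \<in> carrier P \<Longrightarrow> \<phi> (Idl\<^bsub>P\<^esub> gens +>\<^bsub>P\<^esub> p) = eval_poly s p"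
    using h.ring.factor_through_quotient by blast
  show ?thesis
  proof (intro bexI ballI)
    show "\<phi> \<in> ring_hom (bracket_ring es E \<B> B T) R"
      using \<phi>(1) unfolding bracket_ring_def ideal_eq P_def .
    show "\<phi> (bracket_matrix es E \<B> B T x y) = A x y" if "x \<in> B" "y \<in> E - B" for x y
      using \<phi>(2)[OF entry_P[OF that]] h_entry[OF that]
      unfolding bracket_matrix_def ideal_eq P_def by simp
  qed
qed

end
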